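(* Let $S$ be a densely defined symmetric operator in a complex Hilbert space $\mathcal{H}$, with closure $\overline{S}$, such that $0$ is a regular point of $\overline{S}$ (i.e. $\overline{S}$ is injective with bounded inverse $\overline{S}^{-1}:\mathrm{ran}\,\overline{S}\to\mathcal{H}$) and such that the deficiency index satisfies $d(S)\geqslant 1$. Let $S_{\mathrm{D}}$ be the distinguished self-adjoint extension of $S$, with everywhere defined and bounded inverse. With the maps $\Gamma_0,\Gamma_1,\Gamma_{0,\varepsilon},\Gamma_{1,\varepsilon}^{\pm}$ on $\mathcal{D}(S^* )$ defined in the context, the following holds for every $\varepsilon>0$ (for either choice of sign): (i) $\big\|P_{\ker(S^*\pm\mathrm{i}\varepsilon\mathbf{1})}-P_{\ker S^*}\big\|_{\mathrm{op}}\leqslant\varepsilon\,\|\overline{S}^{-1}\|_{\mathrm{op}}$; in particular, $P_{\ker(S^*\pm\mathrm{i}\varepsilon\mathbf{1})}\to P_{\ker S^*}$ in operator norm as $\varepsilon\downarrow 0$. (ii) $\|\Gamma_{1,\varepsilon}^{\pm}g-\Gamma_1 g\|_{\mathcal{H}}\leqslant\varepsilon\big(\|g\|_{\mathcal{H}}+\|\overline{S}^{-1}\|_{\mathrm{op}}\|S^*g\|_{\mathcal{H}}\big)$ for every $g\in\mathcal{D}(S^* )$; in particular, $\Gamma_{1,\varepsilon}^{\pm}\to\Gamma_1$ strongly on $\mathcal{D}(S^* )$ as $\varepsilon\downarrow 0$. (iii) $\|\Gamma_{0,\varepsilon}g-\Gamma_0 g\|_{\mathcal{H}}\leqslant\varepsilon\big(\|\overline{S}^{-1}\|_{\mathrm{op}}+\|S_{\mathrm{D}}^{-1}\|_{\mathrm{op}}\big)\big(\|g\|_{\mathcal{H}}+\|\overline{S}^{-1}\|_{\mathrm{op}}\|S^*g\|_{\mathcal{H}}\big)$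 for every $g\in\mathcal{D}(S^* )$; in particular, $\Gamma_{0,\varepsilon}\to\Gamma_0$ strongly on $\mathcal{D}(S^* )$ as $\varepsilon\downarrow 0$.
   Context: Scalar products are linear in the second entry. $P_W$ denotes the orthogonal projection of $\mathcal{H}$ onto a closed subspace $W$. $\mathbf{1}$ is the identity operator. $\|\overline{S}^{-1}\|_{\mathrm{op}}$ is the norm of $\overline{S}^{-1}$ as a bounded operator from the closed subspace $\mathrm{ran}\,\overline{S}$ to $\mathcal{H}$. The deficiency index $d(S):=\dim\ker(S^*-z\mathbf{1})$ is, under the given assumptions, the same cardinal for all $z\in\mathbb{C}^+\cup\{0\}\cup\mathbb{C}^-$. It is a known fact (Calkin) that, under these assumptions, $S$ has a self-adjoint extension with everywhere defined bounded inverse on $\mathcal{H}$; $S_{\mathrm{D}}$ denotes one such extension, fixed once and for all. Known decompositions ($\dotplus$ is the direct algebraic sum), for every $\varepsilon>0$: $\mathcal{D}(S^* )=\mathcal{D}(\overline{S})\dotplus\ker(S^*-\mathrm{i}\varepsilon\mathbf{1})\dotplus\ker(S^*+\mathrm{i}\varepsilon\mathbf{1})$ and $\mathcal{D}(S^* )=\mathcal{D}(\overline{S})\dotplus S_{\mathrm{D}}^{-1}\ker S^*\dotplus\ker S^*$. Definitions of the maps, all with domain $\mathcal{D}(S^* )$: $\Gamma_0:=\mathbf{1}-S_{\mathrm{D}}^{-1}S^*$ and $\Gamma_1:=P_{\ker S^*}S^*$, both with values in $\ker S^*$; $\Gamma_{1,\varepsilon}^-:=P_{\ker(S^*-\mathrm{i}\varepsilon\mathbf{1})}(S^*+\mathrm{i}\varepsilon\mathbf{1})$;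 $\Gamma_{1,\varepsilon}^+:=P_{\ker(S^*+\mathrm{i}\varepsilon\mathbf{1})}(S^*-\mathrm{i}\varepsilon\mathbf{1})$; $\Upsilon_\varepsilon:=\dfrac{\Gamma_{1,\varepsilon}^--\Gamma_{1,\varepsilon}^+}{2\mathrm{i}\varepsilon}$ (which takes values in $\mathcal{D}(S^* )$); $\Gamma_{0,\varepsilon}:=\Gamma_0\Upsilon_\varepsilon$. *)

theory Defs
  imports "HOL-Analysis.Analysis"
begin

section \<open>Complex Hilbert spaces\<close>

class complex_vector = real_vector +
  fixes scaleC :: "complex \<Rightarrow> 'a \<Rightarrow> 'a" (infixr \<open>*\<^sub>C\<close> 75)
  assumes scaleC_add_right: "a *\<^sub>C (x + y) = a *\<^sub>C x + a *\<^sub>C y"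
    and scaleC_add_left: "(a + b) *\<^sub>C x = a *\<^sub>C x + b *\<^sub>C x"
    and scaleC_scaleC: "a *\<^sub>C b *\<^sub>C x = (a * b) *\<^sub>C x"
    and scaleC_one: "1 *\<^sub>C x = x"
    and scaleR_scaleC: "r *\<^sub>R x = complex_of_real r *\<^sub>C x"

global_interpretation complex_vector: vector_space "scaleC :: complex \<Rightarrow> 'a \<Rightarrow> 'a::complex_vector"
  defines csubspace = complex_vector.subspace
    and cspan = complex_vector.span
  by unfold_locales (simp_all add: scaleC_add_right scaleC_add_left scaleC_scaleC scaleC_one)

text \<open>The scalar product is linear in the second argument. The normed-space axioms of the
  parent class would follow from the axioms on \<open>cinner\<close>; inheriting them is a convenience.\<close>

class complex_inner = complex_vector + real_normed_vector +
  fixes cinner :: "'a \<Rightarrow> 'a \<Rightarrow> complex"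
  assumes cinner_commute: "cinner x y = cnj (cinner y x)"
    and cinner_add_right: "cinner x (y + z) = cinner x y + cinner x z"
    and cinner_scaleC_right: "cinner x (c *\<^sub>C y) = c * cinner x y"
    and norm_cinner: "cinner x x = complex_of_real ((norm x)\<^sup>2)"

class complex_hilbert = complex_inner + complete_space

instantiation complex :: complex_hilbert
begin
definition scaleC_complex :: "complex \<Rightarrow> complex \<Rightarrow> complex"
  where "scaleC_complex c x = c * x"
definition cinner_complex :: "complex \<Rightarrow> complex \<Rightarrow> complex"
  where "cinner_complex x y = cnj x * y"
instance
proof
  fix x :: complex
  show "cinner x x = complex_of_real ((norm x)\<^sup>2)"
    using complex_norm_square[of x] by (simp add: cinner_complex_def mult.commute)
qed (simp_all add: scaleC_complex_def cinner_complex_def algebra_simps scaleR_conv_of_real)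
end

instantiation prod :: (complex_vector, complex_vector) complex_vector
begin
definition scaleC_prod :: "complex \<Rightarrow> 'a \<times> 'b \<Rightarrow> 'a \<times> 'b"
  where "scaleC_prod c p = (c *\<^sub>C fst p, c *\<^sub>C snd p)"
instance
  by standard
    (simp_all add: scaleC_prod_def prod_eq_iff scaleC_add_right scaleC_add_left scaleC_scaleC
      scaleC_one scaleR_scaleC)
end

text \<open>Orthogonal projection onto \<open>W\<close>; meaningful for closed subspaces \<open>W\<close> of a Hilbert space.\<close>

definition orth_proj :: "'a::complex_inner set \<Rightarrow> 'a \<Rightarrow> 'a" where
  "orth_proj W x = (THE p. p \<in> W \<and> (\<forall>w\<in>W. cinner w (x - p) = 0))"

definition is_onb :: "'a::complex_inner set \<Rightarrow> 'a set \<Rightarrow> bool" where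
  "is_onb B W \<longleftrightarrow>
     B \<subseteq> W \<and> (\<forall>b\<in>B. norm b = 1) \<and> (\<forall>b\<in>B. \<forall>c\<in>B. b \<noteq> c \<longrightarrow> cinner b c = 0) \<and>
     W \<subseteq> closure (cspan B)"

text \<open>Hilbert dimension of a closed subspace, as a cardinal (determined up to \<open>ordIso\<close>).\<close>

definition hilbert_dim :: "'a::complex_inner set \<Rightarrow> 'a rel" where
  "hilbert_dim W = card_of (SOME B. is_onb B W)"


section \<open>Unbounded operators\<close>

text \<open>An operator in \<open>\<H>\<close> is identified with its graph, a set of pairs \<open>(x, T x)\<close>. Thus
  \<open>Domain T\<close> and \<open>Range T\<close> are its domain and range, \<open>T \<subseteq> T'\<close> says that \<open>T'\<close> extends \<open>T\<close>,
  \<open>closure T\<close> (in the product topology) is the closure of a closable operator, and \<open>T\<inverse>\<close>, with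
  domain \<open>Range T\<close>, is the inverse of an injective one.\<close>

definition linear_op :: "('a::complex_vector \<times> 'a) set \<Rightarrow> bool" where
  "linear_op T \<longleftrightarrow> csubspace T \<and> single_valued T"

definition op_app :: "('a \<times> 'a) set \<Rightarrow> 'a \<Rightarrow> 'a" where
  "op_app T x = (THE y. (x, y) \<in> T)"

definition op_ker :: "('a::zero \<times> 'a) set \<Rightarrow> 'a set" where
  "op_ker T = {x. (x, 0) \<in> T}"

text \<open>The operator \<open>T - z\<one>\<close>.\<close>

definition op_minus :: "('a::complex_vector \<times> 'a) set \<Rightarrow> complex \<Rightarrow> ('a \<times> 'a) set" where
  "op_minus T z = {(x, y - z *\<^sub>C x) | x y. (x, y) \<in> T}"

definition densely_defined :: "('a::topological_space \<times> 'a) set \<Rightarrow> bool" where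
  "densely_defined T \<longleftrightarrow> closure (Domain T) = UNIV"

text \<open>The graph of the adjoint; an operator when \<open>T\<close> is densely defined.\<close>

definition op_adj :: "('a::complex_inner \<times> 'a) set \<Rightarrow> ('a \<times> 'a) set" where
  "op_adj T = {(y, v). \<forall>(x, u)\<in>T. cinner y u = cinner v x}"

definition symmetric_op :: "('a::complex_inner \<times> 'a) set \<Rightarrow> bool" where
  "symmetric_op T \<longleftrightarrow> linear_op T \<and> (\<forall>(x, u)\<in>T. \<forall>(y, v)\<in>T. cinner x v = cinner u y)"

definition selfadjoint_op :: "('a::complex_inner \<times> 'a) set \<Rightarrow> bool" where
  "selfadjoint_op T \<longleftrightarrow> linear_op T \<and> densely_defined T \<and> op_adj T = T"

text \<open>Boundedness and operator norm are taken over the domain of \<open>T\<close> only. As in \<^const>\<open>onorm\<close>,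
  the supremum includes the pair \<open>(0, 0)\<close>, whose quotient is \<open>0\<close>.\<close>

definition bounded_op :: "('a::real_normed_vector \<times> 'a) set \<Rightarrow> bool" where
  "bounded_op T \<longleftrightarrow> (\<exists>C. \<forall>(x, y)\<in>T. norm y \<le> C * norm x)"

definition op_norm :: "('a::real_normed_vector \<times> 'a) set \<Rightarrow> real" where
  "op_norm T = (SUP (x, y)\<in>T. norm y / norm x)"

definition zero_regular :: "('a::real_normed_vector \<times> 'a) set \<Rightarrow> bool" where
  "zero_regular T \<longleftrightarrow> single_valued (T\<inverse>) \<and> bounded_op (T\<inverse>)"

text \<open>The kernel of \<open>S\<^sup>* - z\<one>\<close>. When \<open>S\<close> is densely defined and symmetric and \<open>0\<close> is a regular
  point of its closure, its dimension does not depend on \<open>z\<close>, as long as \<open>z = 0\<close> or \<open>z\<close> is not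
  real; this is the deficiency index.\<close>

definition def_space :: "('a::complex_inner \<times> 'a) set \<Rightarrow> complex \<Rightarrow> 'a set" where
  "def_space S z = op_ker (op_minus (op_adj S) z)"

definition deficiency_index :: "('a::complex_inner \<times> 'a) set \<Rightarrow> complex \<Rightarrow> 'a rel" where
  "deficiency_index S z = hilbert_dim (def_space S z)"


section \<open>The maps on the domain of the adjoint\<close>

text \<open>All maps below are meant on \<open>Domain (op_adj S)\<close>; elsewhere their values are irrelevant.\<close>

definition Gamma0 :: "('a::complex_inner \<times> 'a) set \<Rightarrow> ('a \<times> 'a) set \<Rightarrow> 'a \<Rightarrow> 'a" where
  "Gamma0 S S\<^sub>D g = g - op_app (S\<^sub>D\<inverse>) (op_app (op_adj S) g)"

definition Gamma1 :: "('a::complex_inner \<times> 'a) set \<Rightarrow> 'a \<Rightarrow> 'a" where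
  "Gamma1 S g = orth_proj (op_ker (op_adj S)) (op_app (op_adj S) g)"

definition Gamma1_minus :: "('a::complex_inner \<times> 'a) set \<Rightarrow> real \<Rightarrow> 'a \<Rightarrow> 'a" where
  "Gamma1_minus S \<epsilon> g =
     orth_proj (def_space S (\<i> * \<epsilon>)) (op_app (op_minus (op_adj S) (- (\<i> * \<epsilon>))) g)"

definition Gamma1_plus :: "('a::complex_inner \<times> 'a) set \<Rightarrow> real \<Rightarrow> 'a \<Rightarrow> 'a" where
  "Gamma1_plus S \<epsilon> g =
     orth_proj (def_space S (- (\<i> * \<epsilon>))) (op_app (op_minus (op_adj S) (\<i> * \<epsilon>)) g)"

definition Upsilon :: "('a::complex_inner \<times> 'a) set \<Rightarrow> real \<Rightarrow> 'a \<Rightarrow> 'a" where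
  "Upsilon S \<epsilon> g = (1 / (2 * \<i> * \<epsilon>)) *\<^sub>C (Gamma1_minus S \<epsilon> g - Gamma1_plus S \<epsilon> g)"

definition Gamma0_eps ::
    "('a::complex_inner \<times> 'a) set \<Rightarrow> ('a \<times> 'a) set \<Rightarrow> real \<Rightarrow> 'a \<Rightarrow> 'a" where
  "Gamma0_eps S S\<^sub>D \<epsilon> g = Gamma0 S S\<^sub>D (Upsilon S \<epsilon> g)"

end

(* Let C be the norm of the inverse of the closure of S. For purely imaginary z one has
   norm ((S - cnj z) x)^2 = norm (S x)^2 + |z|^2 * norm x^2, hence
   norm x <= C * norm ((S - cnj z) x). The range of S - cnj z has orthogonal complement
   ker (S* - z), so each of ker (S* - z) and ker S* lies in the other up to a relative error
   |z| * C. This bounds the difference of the two projections and gives (i); (ii) is a direct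
   consequence. For (iii), writing g = f + u_+ + u_- by von Neumann's formula, one finds
   Upsilon g = u_+ + u_- = g - f with f in the domain of the closure of S. As S_D extends that
   closure, Gamma_0 vanishes on f, so that Gamma_{0,eps} and Gamma_0 actually coincide. *)
theory Submission
  imports Defs
begin

section \<open>Geometry of complex Hilbert spaces\<close>

lemma cinner_add_left: "cinner (x + y) z = cinner x z + cinner y (z::'a::complex_inner)"
  by (metis cinner_add_right cinner_commute complex_cnj_add)

lemma cinner_scaleC_left: "cinner (c *\<^sub>C x) y = cnj c * cinner x (y::'a::complex_inner)"
  by (metis cinner_commute cinner_scaleC_right complex_cnj_mult)

lemma cinner_zero_right [simp]: "cinner x (0::'a::complex_inner) = 0"
  using cinner_add_right[of x 0 0] by simp

lemma cinner_zero_left [simp]: "cinner 0 (x::'a::complex_inner) = 0"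
  using cinner_add_left[of 0 0 x] by simp

lemma cinner_minus_right: "cinner x (- y) = - cinner x (y::'a::complex_inner)"
  using cinner_add_right[of x y "- y"] by (simp add: add_eq_0_iff)

lemma cinner_minus_left: "cinner (- x) y = - cinner x (y::'a::complex_inner)"
  using cinner_add_left[of x "- x" y] by (simp add: add_eq_0_iff)

lemma cinner_diff_right: "cinner x (y - z) = cinner x y - cinner x (z::'a::complex_inner)"
  using cinner_add_right[of x y "- z"] by (simp add: cinner_minus_right)

lemma cinner_diff_left: "cinner (x - y) z = cinner x z - cinner y (z::'a::complex_inner)"
  using cinner_add_left[of x "- y" z] by (simp add: cinner_minus_left)

lemma cinner_eq_0_commute: "cinner x y = 0 \<longleftrightarrow> cinner y (x::'a::complex_inner) = 0"
  by (metis cinner_commute complex_cnj_zero_iff)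

lemma norm_scaleC: "norm (c *\<^sub>C x) = norm c * norm (x::'a::complex_inner)"
proof -
  have "complex_of_real ((norm (c *\<^sub>C x))\<^sup>2) = (c * cnj c) * complex_of_real ((norm x)\<^sup>2)"
    unfolding norm_cinner[symmetric] by (simp add: cinner_scaleC_left cinner_scaleC_right)
  also have "\<dots> = complex_of_real ((norm c * norm x)\<^sup>2)"
    by (simp add: complex_norm_square[symmetric] power_mult_distrib)
  finally have "(norm (c *\<^sub>C x))\<^sup>2 = (norm c * norm x)\<^sup>2"
    by (simp only: of_real_eq_iff)
  then show ?thesis
    by (simp add: power2_eq_iff_nonneg)
qed

lemma norm_add_sq: "(norm (x + y))\<^sup>2 = (norm x)\<^sup>2 + (norm y)\<^sup>2 + 2 * Re (cinner x (y::'a::complex_inner))"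
proof -
  have "complex_of_real ((norm (x + y))\<^sup>2)
      = of_real ((norm x)\<^sup>2) + of_real ((norm y)\<^sup>2) + (cinner x y + cnj (cinner x y))"
    unfolding norm_cinner[symmetric] cinner_commute[of y x, symmetric]
    by (simp add: cinner_add_left cinner_add_right)
  also have "\<dots> = complex_of_real ((norm x)\<^sup>2 + (norm y)\<^sup>2 + 2 * Re (cinner x y))"
    by (simp add: complex_add_cnj)
  finally show ?thesis by (simp only: of_real_eq_iff)
qed

lemma norm_diff_sq: "(norm (x - y))\<^sup>2 = (norm x)\<^sup>2 + (norm y)\<^sup>2 - 2 * Re (cinner x (y::'a::complex_inner))"
  using norm_add_sq[of x "- y"] by (simp add: cinner_minus_right)

lemma parallelogram_law:
  "(norm (x + y))\<^sup>2 + (norm (x - y))\<^sup>2 = 2 * (norm x)\<^sup>2 + 2 * (norm (y::'a::complex_inner))\<^sup>2"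
  by (simp add: norm_add_sq norm_diff_sq)

lemma norm_add_sq_orthogonal:
  "cinner x y = 0 \<Longrightarrow> (norm (x + y))\<^sup>2 = (norm x)\<^sup>2 + (norm (y::'a::complex_inner))\<^sup>2"
  by (simp add: norm_add_sq)

text \<open>Pythagoras for the splitting of \<open>z\<close> into its component along
  \<open>w\<close> and the rest. It yields both the Cauchy-Schwarz inequality and the minimality
  criterion behind the projection theorem.\<close>

lemma norm_diff_component_sq:
  fixes w z :: "'a::complex_inner"
  assumes "w \<noteq> 0"
  shows "(norm (z - (cinner w z / of_real ((norm w)\<^sup>2)) *\<^sub>C w))\<^sup>2
       = (norm z)\<^sup>2 - (norm (cinner w z))\<^sup>2 / (norm w)\<^sup>2"
proof -
  have "cinner w z * cinner z w = complex_of_real ((norm (cinner w z))\<^sup>2)"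
    unfolding complex_norm_square by (metis cinner_commute)
  then have "cinner z ((cinner w z / of_real ((norm w)\<^sup>2)) *\<^sub>C w)
      = complex_of_real ((norm (cinner w z))\<^sup>2 / (norm w)\<^sup>2)"
    by (simp add: cinner_scaleC_right)
  then have "Re (cinner z ((cinner w z / of_real ((norm w)\<^sup>2)) *\<^sub>C w))
      = (norm (cinner w z))\<^sup>2 / (norm w)\<^sup>2"
    by (simp only: Re_complex_of_real)
  moreover have "(norm ((cinner w z / of_real ((norm w)\<^sup>2)) *\<^sub>C w))\<^sup>2
      = (norm (cinner w z))\<^sup>2 / (norm w)\<^sup>2"
    using assms
    by (simp add: norm_scaleC norm_divide norm_power power_divide power_mult_distrib
        divide_simps flip: power_add)
  ultimately show ?thesis
    by (simp add: norm_diff_sq)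
qed

lemma Cauchy_Schwarz_cinner: "norm (cinner x y) \<le> norm x * norm (y::'a::complex_inner)"
proof (cases "x = 0")
  case False
  then have "(norm (cinner x y))\<^sup>2 / (norm x)\<^sup>2 \<le> (norm y)\<^sup>2"
    using norm_diff_component_sq[OF False, of y] zero_le_power2 by (smt (verit))
  with False have "(norm (cinner x y))\<^sup>2 \<le> (norm x * norm y)\<^sup>2"
    by (simp add: divide_simps power_mult_distrib mult.commute)
  then show ?thesis
    by (simp add: power2_le_iff_abs_le)
qed simp

text \<open>Conjugate linearity in the first entry is still linearity over the reals, so the real
  notion of a bounded bilinear map applies and supplies continuity.\<close>

lemma bounded_bilinear_cinner: "bounded_bilinear (cinner :: 'a::complex_inner \<Rightarrow> 'a \<Rightarrow> complex)"
proof
  show "\<exists>K. \<forall>a b. norm (cinner (a::'a) b) \<le> norm a * norm b * K"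
    using Cauchy_Schwarz_cinner[where 'a='a] by (intro exI[of _ 1]) simp
qed (simp_all add: cinner_add_left cinner_add_right scaleR_scaleC cinner_scaleC_left
      cinner_scaleC_right scaleC_complex_def)

lemmas continuous_on_cinner [continuous_intros] =
  bounded_bilinear.continuous_on[OF bounded_bilinear_cinner]

lemma bounded_linear_scaleC: "bounded_linear (\<lambda>x::'a::complex_inner. c *\<^sub>C x)"
  by (intro bounded_linear_intro[of _ "norm c"])
    (simp_all add: scaleC_add_right scaleR_scaleC scaleC_scaleC norm_scaleC mult.commute)

lemmas tendsto_scaleC [tendsto_intros] = bounded_linear.tendsto[OF bounded_linear_scaleC]

section \<open>Orthogonal complements and the projection theorem\<close>

definition orth_compl :: "'a::complex_inner set \<Rightarrow> 'a set" where
  "orth_compl W = {y. \<forall>w\<in>W. cinner w y = 0}"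

lemma orth_compl_csubspace: "csubspace (orth_compl W)"
  by (simp add: complex_vector.subspace_def orth_compl_def cinner_add_right cinner_scaleC_right)

lemma orth_compl_closed: "closed (orth_compl W)"
proof -
  have "orth_compl W = (\<Inter>w\<in>W. {y. cinner w y = 0})"
    by (auto simp: orth_compl_def)
  then show ?thesis
    by (auto intro!: closed_INT closed_Collect_eq continuous_intros)
qed

lemma csubspace_closure:
  fixes W :: "'a::complex_inner set"
  assumes "csubspace W"
  shows "csubspace (closure W)"
  unfolding complex_vector.subspace_def
proof (intro conjI ballI allI)
  show "0 \<in> closure W"
    using assms complex_vector.subspace_0 closure_subset by blast
next
  fix x y assume "x \<in> closure W" "y \<in> closure W"
  then obtain a b where "\<And>n. a n \<in> W" "a \<longlonglongrightarrow> x" "\<And>n. b n \<in> W" "b \<longlonglongrightarrow> y"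
    unfolding closure_sequential by blast
  then show "x + y \<in> closure W"
    unfolding closure_sequential
    by (intro exI[of _ "\<lambda>n. a n + b n"]) (simp add: tendsto_add complex_vector.subspace_add[OF assms])
next
  fix c x assume "x \<in> closure W"
  then obtain a where "\<And>n. a n \<in> W" "a \<longlonglongrightarrow> x"
    unfolding closure_sequential by blast
  then show "c *\<^sub>C x \<in> closure W"
    unfolding closure_sequential
    by (intro exI[of _ "\<lambda>n. c *\<^sub>C a n"])
      (simp add: tendsto_scaleC complex_vector.subspace_scale[OF assms])
qed

text \<open>Two candidates differ by an element of \<open>W\<close>, to which both residuals are
  orthogonal, so the difference is orthogonal to itself. This evaluates the definite description in
  \<open>orth_proj\<close>.\<close>

lemma orth_proj_unique:
  fixes W :: "'a::complex_inner set"
  assumes "csubspace W" "p \<in> W" "x - p \<in> orth_compl W"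
  shows "orth_proj W x = p"
  unfolding orth_proj_def
proof (rule the_equality)
  show "p \<in> W \<and> (\<forall>w\<in>W. cinner w (x - p) = 0)"
    using assms by (simp add: orth_compl_def)
next
  fix q assume q: "q \<in> W \<and> (\<forall>w\<in>W. cinner w (x - q) = 0)"
  have "p - q \<in> W"
    using assms q complex_vector.subspace_diff by blast
  then have "cinner (p - q) (x - q) - cinner (p - q) (x - p) = 0"
    using assms q by (simp add: orth_compl_def)
  then have "cinner (p - q) (p - q) = 0"
    by (simp add: cinner_diff_right)
  then show "q = p"
    by (simp add: norm_cinner)
qed

text \<open>Subtracting the component along \<open>w\<close> lowers the squared norm of
  \<open>z\<close> by a multiple of the squared modulus of \<open>cinner w z\<close>; minimality
  forces this gain to vanish.\<close>

lemma orthogonal_if_norm_minimal: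
  fixes z w :: "'a::complex_inner"
  assumes "\<And>c. norm z \<le> norm (z - c *\<^sub>C w)"
  shows "cinner w z = 0"
proof (cases "w = 0")
  case False
  have "(norm z)\<^sup>2 \<le> (norm z)\<^sup>2 - (norm (cinner w z))\<^sup>2 / (norm w)\<^sup>2"
    unfolding norm_diff_component_sq[OF False, symmetric]
    by (intro power_mono assms) simp
  with False show ?thesis
    by (simp add: divide_le_0_iff)
qed simp

text \<open>A minimizing sequence for the distance from \<open>x\<close> to \<open>W\<close> is
  Cauchy by the parallelogram law. Its limit attains the distance, and minimality along every
  direction in \<open>W\<close> gives orthogonality.\<close>

lemma orthogonal_decomposition:
  fixes W :: "'a::complex_hilbert set"
  assumes W: "csubspace W" "closed W"
  obtains p where "p \<in> W" "x - p \<in> orth_compl W"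
proof -
  define D where "D = (INF w\<in>W. (norm (x - w))\<^sup>2)"
  have W0: "0 \<in> W"
    using W complex_vector.subspace_0 by blast
  have bdd: "bdd_below ((\<lambda>w. (norm (x - w))\<^sup>2) ` W)"
    by (intro bdd_belowI[of _ 0]) auto
  have D_le: "D \<le> (norm (x - w))\<^sup>2" if "w \<in> W" for w
    unfolding D_def using that bdd by (intro cINF_lower)
  have "\<exists>w\<in>W. (norm (x - w))\<^sup>2 < D + 1 / real (Suc n)" for n
  proof -
    have "D < D + 1 / real (Suc n)" by simp
    then show ?thesis
      unfolding D_def using W0 by (subst (asm) cINF_less_iff[OF _ bdd]) auto
  qed
  then obtain a where aW: "\<And>n. a n \<in> W" and a: "\<And>n. (norm (x - a n))\<^sup>2 < D + 1 / real (Suc n)"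
    by metis
  \<comment> \<open>The midpoint of \<open>a m\<close> and \<open>a n\<close> stays in
    \<open>W\<close>, so the sum in the parallelogram law has squared norm at least
    \<open>4 * D\<close>. This cancels the \<open>4 * D\<close> coming from the two nearly minimal
    terms.\<close>
  have dist_a: "(norm (a m - a n))\<^sup>2 \<le> 2 / real (Suc m) + 2 / real (Suc n)" for m n
  proof -
    define mid where "mid = (1/2::complex) *\<^sub>C (a m + a n)"
    have "(x - a m) + (x - a n) = 2 *\<^sub>C (x - mid)"
      unfolding mid_def
      by (simp add: complex_vector.scale_right_diff_distrib scaleC_scaleC scaleC_one)
        (metis (no_types) one_add_one scaleC_add_left scaleC_one)
    then have "(norm ((x - a m) + (x - a n)))\<^sup>2 = 4 * (norm (x - mid))\<^sup>2"
      by (simp add: norm_scaleC power_mult_distrib)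
    moreover have "mid \<in> W"
      unfolding mid_def by (intro complex_vector.subspace_scale complex_vector.subspace_add W aW)
    moreover have "norm ((x - a m) - (x - a n)) = norm (a m - a n)"
      by (simp add: norm_minus_commute)
    ultimately show ?thesis
      using D_le[of mid] a[of m] a[of n] parallelogram_law[of "x - a m" "x - a n"] by simp
  qed
  have "Cauchy a"
  proof (rule CauchyI)
    fix e :: real assume e: "0 < e"
    \<comment> \<open>Beyond \<open>N\<close> each of the two terms of \<open>dist_a\<close> is at
      most twice \<open>inverse (real (Suc N))\<close>, hence below half of the square of
      \<open>e\<close>.\<close>
    then obtain N where N: "inverse (real (Suc N)) < e\<^sup>2 / 4"
      using reals_Archimedean[of "e\<^sup>2 / 4"] by auto
    show "\<exists>M. \<forall>m\<ge>M. \<forall>n\<ge>M. norm (a m - a n) < e"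
    proof (intro exI allI impI)
      fix m n assume mn: "N \<le> m" "N \<le> n"
      have le: "1 / real (Suc k) \<le> inverse (real (Suc N))" if "N \<le> k" for k
        using that by (simp add: divide_simps)
      have "(norm (a m - a n))\<^sup>2 < e\<^sup>2"
        using dist_a[of m n] le[OF mn(1)] le[OF mn(2)] N by simp
      then show "norm (a m - a n) < e"
        using e power2_less_imp_less by fastforce
    qed
  qed
  then obtain p where p: "a \<longlonglongrightarrow> p"
    using Cauchy_convergent convergent_def by blast
  have pW: "p \<in> W"
    using W(2) aW p closed_sequential_limits by blast
  have "(norm (x - p))\<^sup>2 \<le> D"
  proof (rule LIMSEQ_le)
    show "(\<lambda>n. (norm (x - a n))\<^sup>2) \<longlonglongrightarrow> (norm (x - p))\<^sup>2"
      by (intro tendsto_intros p)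
    show "(\<lambda>n. D + 1 / real (Suc n)) \<longlonglongrightarrow> D"
      using tendsto_add[OF tendsto_const LIMSEQ_inverse_real_of_nat, of D] by (simp add: divide_inverse)
    show "\<exists>N. \<forall>n\<ge>N. (norm (x - a n))\<^sup>2 \<le> D + 1 / real (Suc n)"
      using a less_imp_le by blast
  qed
  have "cinner w (x - p) = 0" if "w \<in> W" for w
  proof (rule orthogonal_if_norm_minimal)
    fix c
    have "p + c *\<^sub>C w \<in> W"
      by (intro complex_vector.subspace_scale complex_vector.subspace_add W pW that)
    then have "(norm (x - p))\<^sup>2 \<le> (norm (x - (p + c *\<^sub>C w)))\<^sup>2"
      by (intro order_trans[OF \<open>(norm (x - p))\<^sup>2 \<le> D\<close> D_le])
    then show "norm (x - p) \<le> norm (x - p - c *\<^sub>C w)"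
      unfolding diff_diff_eq by (rule power2_le_imp_le) simp
  qed
  then have "x - p \<in> orth_compl W"
    unfolding orth_compl_def by blast
  with pW show thesis
    by (rule that)
qed

lemma orth_proj_in:
  fixes W :: "'a::complex_hilbert set"
  assumes "csubspace W" "closed W"
  shows "orth_proj W x \<in> W" and "x - orth_proj W x \<in> orth_compl W"
proof -
  obtain p where "p \<in> W" "x - p \<in> orth_compl W"
    using orthogonal_decomposition[OF assms] .
  with orth_proj_unique[OF assms(1) this]
  show "orth_proj W x \<in> W" "x - orth_proj W x \<in> orth_compl W"
    by simp_all
qed

lemma orth_proj_compl_in:
  fixes x :: "'a::complex_hilbert"
  shows "orth_proj (orth_compl W) x \<in> orth_compl W"
    and "x - orth_proj (orth_compl W) x \<in> orth_compl (orth_compl W)"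
  using orth_proj_in[OF orth_compl_csubspace orth_compl_closed] by blast+

text \<open>Project \<open>y\<close> to \<open>p\<close> in the closure of \<open>W\<close>. The
  residual lies in \<open>orth_compl W\<close>, hence is orthogonal to \<open>y\<close>; it is also
  orthogonal to \<open>p\<close>, therefore to itself.\<close>

lemma orth_compl_orth_compl:
  fixes W :: "'a::complex_hilbert set"
  assumes "csubspace W" "y \<in> orth_compl (orth_compl W)"
  shows "y \<in> closure W"
proof -
  obtain p where p: "p \<in> closure W" "y - p \<in> orth_compl (closure W)"
    using orthogonal_decomposition[OF csubspace_closure[OF assms(1)] closed_closure] .
  then have "y - p \<in> orth_compl W"
    using closure_subset[of W] unfolding orth_compl_def by blast
  then have "cinner (y - p) y = 0" "cinner (y - p) p = 0"
    using assms(2) p cinner_eq_0_commute[of p "y - p"] by (auto simp: orth_compl_def)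
  then have "cinner (y - p) (y - p) = 0"
    by (simp add: cinner_diff_right)
  with p show ?thesis
    by (simp add: norm_cinner)
qed

section \<open>Norm estimates for projections and their differences\<close>

lemma orth_proj_add:
  fixes W :: "'a::complex_hilbert set"
  assumes "csubspace W" "closed W"
  shows "orth_proj W (x + y) = orth_proj W x + orth_proj W y"
proof (rule orth_proj_unique[OF assms(1)])
  note P = orth_proj_in[OF assms]
  show "orth_proj W x + orth_proj W y \<in> W"
    by (intro complex_vector.subspace_add P(1) assms(1))
  have "(x - orth_proj W x) + (y - orth_proj W y) \<in> orth_compl W"
    by (intro complex_vector.subspace_add P(2) orth_compl_csubspace)
  then show "x + y - (orth_proj W x + orth_proj W y) \<in> orth_compl W"
    by (simp add: algebra_simps)
qed

lemma orth_proj_pythagoras: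
  fixes W :: "'a::complex_hilbert set"
  assumes "csubspace W" "closed W"
  shows "(norm x)\<^sup>2 = (norm (orth_proj W x))\<^sup>2 + (norm (x - orth_proj W x))\<^sup>2"
proof -
  note P = orth_proj_in[OF assms, of x]
  have "cinner (orth_proj W x) (x - orth_proj W x) = 0"
    using P by (simp add: orth_compl_def)
  from norm_add_sq_orthogonal[OF this] show ?thesis by simp
qed

lemma norm_orth_proj_le:
  fixes W :: "'a::complex_hilbert set"
  assumes "csubspace W" "closed W"
  shows "norm (orth_proj W x) \<le> norm x"
proof (rule power2_le_imp_le)
  show "(norm (orth_proj W x))\<^sup>2 \<le> (norm x)\<^sup>2"
    using orth_proj_pythagoras[OF assms, of x] by simp
qed simp

text \<open>The residual \<open>h\<close> of \<open>f\<close> lies in the closure of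
  \<open>R\<close>, to which the assumed bound extends by continuity. Since \<open>h\<close> is
  orthogonal to the projection of \<open>f\<close>, its squared norm equals
  \<open>cinner h f\<close>, which is at most \<open>c * norm h\<close>.\<close>

lemma norm_diff_orth_proj_compl_le:
  fixes R :: "'a::complex_hilbert set"
  assumes R: "csubspace R" and "0 \<le> c"
    and c: "\<And>h. h \<in> R \<Longrightarrow> norm (cinner h f) \<le> c * norm h"
  shows "norm (f - orth_proj (orth_compl R) f) \<le> c"
proof -
  let ?P = "orth_proj (orth_compl R)"
  note P = orth_proj_compl_in[where W = R and x = f]
  define h where "h = f - ?P f"
  have "closed {h. norm (cinner h f) \<le> c * norm h}"
    by (intro closed_Collect_le continuous_intros)
  then have "closure R \<subseteq> {h. norm (cinner h f) \<le> c * norm h}"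
    using c by (intro closure_minimal) auto
  moreover have "h \<in> closure R"
    unfolding h_def using P(2) orth_compl_orth_compl[OF R] by blast
  ultimately have le: "norm (cinner h f) \<le> c * norm h"
    by blast
  have "cinner h (?P f) = 0"
    using P cinner_eq_0_commute by (auto simp: orth_compl_def h_def)
  then have "cinner h f = of_real ((norm h)\<^sup>2)"
    using cinner_diff_right[of h f "?P f"] by (simp add: norm_cinner flip: h_def)
  with le have "norm h * norm h \<le> c * norm h"
    by (simp add: norm_of_real norm_power power2_eq_square norm_mult)
  with \<open>0 \<le> c\<close> have "norm h \<le> c"
    by (cases "h = 0") simp_all
  then show ?thesis
    by (simp add: h_def)
qed

text \<open>With P and Q the two projections, P x - Q x = P (1 - Q) x - (1 - P) Q x. The two terms
  are orthogonal and at most \<open>c\<close> times the norms of (1 - Q) x and Q x, so applying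
  Pythagoras twice keeps the constant \<open>c\<close> instead of doubling it.\<close>

lemma norm_diff_orth_proj_le:
  fixes R Q :: "'a::complex_hilbert set"
  assumes R: "csubspace R" and Q: "csubspace Q" and "0 \<le> c"
    and RQ: "\<And>h f. h \<in> R \<Longrightarrow> f \<in> orth_compl Q \<Longrightarrow> norm (cinner h f) \<le> c * norm h * norm f"
    and QR: "\<And>h f. h \<in> Q \<Longrightarrow> f \<in> orth_compl R \<Longrightarrow> norm (cinner h f) \<le> c * norm h * norm f"
  shows "norm (orth_proj (orth_compl R) x - orth_proj (orth_compl Q) x) \<le> c * norm x"
proof -
  let ?P = "orth_proj (orth_compl R)" and ?Q = "orth_proj (orth_compl Q)"
  note P_in = orth_proj_compl_in[where W = R]
  note Q_in = orth_proj_compl_in[where W = Q]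
  define y where "y = x - ?Q x"
  have PQ: "norm (f - ?P f) \<le> c * norm f" if "f \<in> orth_compl Q" for f
    using RQ[OF _ that] \<open>0 \<le> c\<close>
    by (intro norm_diff_orth_proj_compl_le[OF R]) (simp_all add: mult_ac)
  have QP: "norm (f - ?Q f) \<le> c * norm f" if "f \<in> orth_compl R" for f
    using QR[OF _ that] \<open>0 \<le> c\<close>
    by (intro norm_diff_orth_proj_compl_le[OF Q]) (simp_all add: mult_ac)
  \<comment> \<open>A bound on P restricted to the range of 1 - Q follows by duality from the bound
    on 1 - Q restricted to the range of P: as \<open>y\<close> is orthogonal to the range of Q,
    \<open>?Q (?P y)\<close> may be subtracted in the first entry.\<close>
  have Py: "norm (?P y) \<le> c * norm y"
  proof -
    have "cinner (?P y) (y - ?P y) = 0"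
      using P_in[where x = y] by (simp add: orth_compl_def)
    then have "of_real ((norm (?P y))\<^sup>2) = cinner (?P y) y"
      by (simp add: cinner_diff_right norm_cinner)
    also have "\<dots> = cinner (?P y - ?Q (?P y)) y"
      using Q_in(1)[of "?P y"] Q_in(2)[of x] by (simp add: cinner_diff_left orth_compl_def y_def)
    finally have "(norm (?P y))\<^sup>2 = norm (cinner (?P y - ?Q (?P y)) y)"
      by (metis norm_of_real abs_power2)
    also have "\<dots> \<le> norm (?P y - ?Q (?P y)) * norm y"
      by (rule Cauchy_Schwarz_cinner)
    also have "\<dots> \<le> (c * norm (?P y)) * norm y"
      using QP P_in(1) by (intro mult_right_mono) auto
    finally have "norm (?P y) * norm (?P y) \<le> (c * norm y) * norm (?P y)"
      by (simp add: power2_eq_square mult_ac)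
    with \<open>0 \<le> c\<close> show ?thesis
      by (cases "?P y = 0") (simp_all only: mult_le_cancel_right, simp_all)
  qed
  define u where "u = ?Q x - ?P (?Q x)"
  have "?P x = ?P y + ?P (?Q x)"
    using orth_proj_add[OF orth_compl_csubspace orth_compl_closed, of R y "?Q x"]
    by (simp add: y_def)
  then have "?P x - ?Q x = ?P y - u"
    by (simp add: u_def)
  moreover have "cinner (?P y) u = 0"
    using P_in(1)[of y] P_in(2)[of "?Q x"] unfolding u_def by (simp add: orth_compl_def)
  ultimately have "(norm (?P x - ?Q x))\<^sup>2 = (norm (?P y))\<^sup>2 + (norm u)\<^sup>2"
    using norm_add_sq_orthogonal[of "?P y" "- u"] by (simp add: cinner_minus_right)
  also have "\<dots> \<le> (c * norm y)\<^sup>2 + (c * norm (?Q x))\<^sup>2"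
    using Py PQ[OF Q_in(1)[of x]] by (intro add_mono power_mono) (simp_all add: u_def)
  also have "\<dots> = (c * norm x)\<^sup>2"
    using orth_proj_pythagoras[OF orth_compl_csubspace orth_compl_closed, of x Q]
    by (simp add: power_mult_distrib y_def algebra_simps)
  finally show ?thesis
    by (rule power2_le_imp_le) (simp add: \<open>0 \<le> c\<close>)
qed

section \<open>Operators and their deficiency spaces\<close>

text \<open>Boundedness makes the supremum in \<open>op_norm\<close> genuine, and the pair
  \<open>(0, 0)\<close> contributes the quotient 0. The inequality at \<open>x = 0\<close>, where
  the quotient says nothing, comes from single-valuedness.\<close>

lemma op_norm_bounded:
  assumes "(0, 0) \<in> T" "single_valued T" "bounded_op T"
  shows "0 \<le> op_norm T"
    and "(x, y) \<in> T \<Longrightarrow> norm y \<le> op_norm T * norm x"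
proof -
  obtain C where C: "\<And>x y. (x, y) \<in> T \<Longrightarrow> norm y \<le> C * norm x"
    using assms(3) by (fastforce simp: bounded_op_def)
  \<comment> \<open>The constant \<open>C\<close> may be negative when 0 is the only point of the
    domain; the absolute value also dominates the quotient 0 arising there.\<close>
  have "norm y / norm x \<le> \<bar>C\<bar>" if "(x, y) \<in> T" for x y
  proof (cases "x = 0")
    case False
    have "C * norm x \<le> \<bar>C\<bar> * norm x" by (intro mult_right_mono) auto
    with C[OF that] have "norm y \<le> \<bar>C\<bar> * norm x" by (rule order_trans)
    with False show ?thesis by (simp add: divide_simps)
  qed simp
  then have bdd: "bdd_above ((\<lambda>(x, y). norm y / norm x) ` T)"
    by (intro bdd_aboveI[of _ "\<bar>C\<bar>"]) auto
  have le: "norm y / norm x \<le> op_norm T" if "(x, y) \<in> T" for x y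
    unfolding op_norm_def using cSUP_upper[OF that bdd] by simp
  show "0 \<le> op_norm T"
    using le[OF assms(1)] by simp
  show "norm y \<le> op_norm T * norm x" if "(x, y) \<in> T"
  proof (cases "x = 0")
    case True
    with that assms have "y = 0" by (meson single_valuedD)
    then show ?thesis using True by simp
  next
    case False
    with le[OF that] show ?thesis by (simp add: divide_simps)
  qed
qed

section \<open>Calculus of operator graphs\<close>

lemma op_app_eq: "single_valued T \<Longrightarrow> (x, y) \<in> T \<Longrightarrow> op_app T x = y"
  unfolding op_app_def by (blast dest: single_valuedD)

lemma op_minus_iff: "(x, y) \<in> op_minus T z \<longleftrightarrow> (x, y + z *\<^sub>C x) \<in> T"
  unfolding op_minus_def by force

lemma single_valued_op_minus: "single_valued T \<Longrightarrow> single_valued (op_minus T z)"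
  by (auto simp: single_valued_def op_minus_iff) (metis add_right_cancel)

lemma op_graph_add:
  "csubspace T \<Longrightarrow> (x, u) \<in> T \<Longrightarrow> (y, v) \<in> T \<Longrightarrow> (x + y, u + v) \<in> T"
  using complex_vector.subspace_add[of T "(x, u)" "(y, v)"] by simp

lemma op_graph_diff:
  "csubspace T \<Longrightarrow> (x, u) \<in> T \<Longrightarrow> (y, v) \<in> T \<Longrightarrow> (x - y, u - v) \<in> T"
  using complex_vector.subspace_diff[of T "(x, u)" "(y, v)"] by simp

lemma op_graph_scale:
  "csubspace T \<Longrightarrow> (x, u) \<in> T \<Longrightarrow> (c *\<^sub>C x, c *\<^sub>C u) \<in> T"
  using complex_vector.subspace_scale[of T "(x, u)" c] by (simp add: scaleC_prod_def)

lemma csubspace_Range_op_minus: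
  assumes T: "csubspace T"
  shows "csubspace (Range (op_minus T z))"
  unfolding complex_vector.subspace_def
proof (intro conjI ballI allI)
  have "(0, 0) \<in> T"
    using complex_vector.subspace_0[OF T] by (simp add: zero_prod_def)
  then show "0 \<in> Range (op_minus T z)"
    by (auto simp: Range_iff op_minus_iff intro!: exI[of _ 0])
next
  fix u v assume "u \<in> Range (op_minus T z)" "v \<in> Range (op_minus T z)"
  then obtain x y where "(x, u + z *\<^sub>C x) \<in> T" "(y, v + z *\<^sub>C y) \<in> T"
    by (auto simp: Range_iff op_minus_iff)
  from op_graph_add[OF T this] show "u + v \<in> Range (op_minus T z)"
    by (auto simp: Range_iff op_minus_iff scaleC_add_right add_ac intro!: exI[of _ "x + y"])
next
  fix c u assume "u \<in> Range (op_minus T z)"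
  then obtain x where "(x, u + z *\<^sub>C x) \<in> T"
    by (auto simp: Range_iff op_minus_iff)
  from op_graph_scale[OF T this, of c] show "c *\<^sub>C u \<in> Range (op_minus T z)"
    by (auto simp: Range_iff op_minus_iff scaleC_add_right scaleC_scaleC mult.commute
        intro!: exI[of _ "c *\<^sub>C x"])
qed

section \<open>Adjoints and deficiency spaces\<close>

lemma op_adj_iff: "(y, v) \<in> op_adj T \<longleftrightarrow> (\<forall>x u. (x, u) \<in> T \<longrightarrow> cinner y u = cinner v x)"
  by (auto simp: op_adj_def)

lemma csubspace_op_adj: "csubspace (op_adj T)"
  by (auto simp: complex_vector.subspace_def op_adj_iff cinner_add_left cinner_scaleC_left
      zero_prod_def scaleC_prod_def)

lemma closed_op_adj: "closed (op_adj T)"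
proof -
  have "op_adj T = (\<Inter>p\<in>T. {q. cinner (fst q) (snd p) = cinner (snd q) (fst p)})"
    unfolding op_adj_def by force
  then show ?thesis
    by (auto intro!: closed_INT closed_Collect_eq continuous_intros)
qed

text \<open>For a fixed pair \<open>(y, v)\<close> the adjoint relation is a closed condition on the
  graph of \<open>T\<close>, so it persists on the closure.\<close>

lemma op_adj_closure: "op_adj (closure T) = op_adj T"
proof
  show "op_adj (closure T) \<subseteq> op_adj T"
    using closure_subset by (fastforce simp: op_adj_def)
  show "op_adj T \<subseteq> op_adj (closure T)"
  proof safe
    fix y v assume yv: "(y, v) \<in> op_adj T"
    have "closed {p. cinner y (snd p) = cinner v (fst p)}"
      by (intro closed_Collect_eq continuous_intros)
    then have "closure T \<subseteq> {p. cinner y (snd p) = cinner v (fst p)}"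
      using yv by (intro closure_minimal) (auto simp: op_adj_def)
    then show "(y, v) \<in> op_adj (closure T)"
      by (auto simp: op_adj_def)
  qed
qed

text \<open>The difference of two values at the same point is orthogonal to the dense domain, hence
  to the whole space and to itself.\<close>

lemma single_valued_op_adj:
  assumes "densely_defined T"
  shows "single_valued (op_adj T)"
proof (rule single_valuedI)
  fix y v w assume "(y, v) \<in> op_adj T" "(y, w) \<in> op_adj T"
  then have "Domain T \<subseteq> {x. cinner (v - w) x = 0}"
    by (fastforce simp: op_adj_def cinner_diff_left)
  moreover have "closed {x. cinner (v - w) x = 0}"
    by (intro closed_Collect_eq continuous_intros)
  ultimately have "closure (Domain T) \<subseteq> {x. cinner (v - w) x = 0}"
    by (intro closure_minimal)
  then have "cinner (v - w) (v - w) = 0"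
    using assms by (auto simp: densely_defined_def)
  then show "v = w"
    by (simp add: norm_cinner)
qed

lemma def_space_iff: "y \<in> def_space T z \<longleftrightarrow> (y, z *\<^sub>C y) \<in> op_adj T"
  by (simp add: def_space_def op_ker_def op_minus_iff)

lemma def_space_0: "def_space T 0 = op_ker (op_adj T)"
  by (auto simp: def_space_iff op_ker_def)

text \<open>Moving \<open>z\<close> to the other entry conjugates it, so the kernel condition is
  orthogonality to all \<open>u - cnj z *\<^sub>C x\<close>. Deficiency spaces thereby become closed
  subspaces to which the estimates for complements apply.\<close>

lemma def_space_eq: "def_space T z = orth_compl (Range (op_minus T (cnj z)))"
proof (intro set_eqI iffI)
  fix y assume y: "y \<in> def_space T z"
  have "cinner y u = 0" if "(x, u + cnj z *\<^sub>C x) \<in> T" for x u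
    using y that by (auto simp: def_space_iff op_adj_def cinner_add_right cinner_scaleC_left
        cinner_scaleC_right)
  then show "y \<in> orth_compl (Range (op_minus T (cnj z)))"
    by (auto simp: orth_compl_def Range_iff op_minus_iff cinner_eq_0_commute[of _ y])
next
  fix y assume y: "y \<in> orth_compl (Range (op_minus T (cnj z)))"
  have "cinner y u = cinner (z *\<^sub>C y) x" if "(x, u) \<in> T" for x u
  proof -
    have "u - cnj z *\<^sub>C x \<in> Range (op_minus T (cnj z))"
      using that by (auto simp: Range_iff op_minus_iff intro!: exI[of _ x])
    then have "cinner y (u - cnj z *\<^sub>C x) = 0"
      using y by (auto simp: orth_compl_def cinner_eq_0_commute[of y])
    then show ?thesis
      by (simp add: cinner_diff_right cinner_scaleC_left cinner_scaleC_right)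
  qed
  then show "y \<in> def_space T z"
    by (auto simp: def_space_iff op_adj_def)
qed

text \<open>The bound makes the supremum genuine, so it is at least the quotient at 0, which is 0.
  This is the lower half of a later squeeze.\<close>

lemma onorm_nonneg_if_bounded:
  assumes "\<And>x. norm (f x) \<le> b * norm x"
  shows "0 \<le> onorm f"
proof -
  have "norm (f x) / norm x \<le> \<bar>b\<bar>" for x
  proof (cases "x = 0")
    case False
    have "b * norm x \<le> \<bar>b\<bar> * norm x" by (intro mult_right_mono) auto
    with assms[of x] have "norm (f x) \<le> \<bar>b\<bar> * norm x" by (rule order_trans)
    with False show ?thesis by (simp add: divide_simps)
  qed simp
  then have "bdd_above (range (\<lambda>x. norm (f x) / norm x))"
    by (intro bdd_aboveI[of _ "\<bar>b\<bar>"]) auto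
  from cSUP_upper[OF UNIV_I this, of 0] show ?thesis
    by (simp add: onorm_def)
qed

section \<open>Symmetric operators whose closure has 0 as a regular point\<close>

locale regular_symmetric_op =
  fixes S :: "('a::complex_hilbert \<times> 'a) set"
  assumes dense: "densely_defined S"
    and symmetric: "symmetric_op S"
    and regular: "zero_regular (closure S)"
begin

lemma csubspace_op: "csubspace S"
  using symmetric by (simp add: symmetric_op_def linear_op_def)

lemma op_subset_adj: "S \<subseteq> op_adj S"
  using symmetric unfolding symmetric_op_def op_adj_def by fastforce

lemma closure_subset_adj: "closure S \<subseteq> op_adj S"
  using op_subset_adj closed_op_adj by (intro closure_minimal)

lemma Im_cinner_op:
  assumes "(x, u) \<in> S" shows "Im (cinner u x) = 0"
proof -
  have "cinner x u = cinner u x"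
    using assms symmetric by (fastforce simp: symmetric_op_def)
  then have "cinner u x = cnj (cinner u x)"
    using cinner_commute[of x u] by simp
  then show ?thesis
    by (simp add: complex_eq_iff)
qed

text \<open>The cross term is the real part of \<open>z * cinner u x\<close>, which vanishes because
  \<open>z\<close> is imaginary and \<open>cinner u x\<close> is real by symmetry.\<close>

lemma norm_op_minus_sq:
  assumes "(x, u) \<in> S" "Re z = 0"
  shows "(norm (u - z *\<^sub>C x))\<^sup>2 = (norm u)\<^sup>2 + (norm z * norm x)\<^sup>2"
  using assms Im_cinner_op[of x u]
  by (simp add: norm_diff_sq cinner_scaleC_right norm_scaleC)

abbreviation inv_norm :: real where
  "inv_norm \<equiv> op_norm ((closure S)\<inverse>)"

lemma inv_norm_nonneg: "0 \<le> inv_norm"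
  and norm_le_inv_norm: "(x, u) \<in> S \<Longrightarrow> norm x \<le> inv_norm * norm u"
proof -
  have "(0, 0) \<in> S"
    using complex_vector.subspace_0[OF csubspace_op] by (simp add: zero_prod_def)
  then have "(0, 0) \<in> (closure S)\<inverse>"
    using closure_subset by blast
  note * = op_norm_bounded[OF this] regular[unfolded zero_regular_def]
  show "0 \<le> inv_norm"
    using * by blast
  show "norm x \<le> inv_norm * norm u" if "(x, u) \<in> S"
    using * that closure_subset by blast
qed

text \<open>The images of \<open>x\<close> under S - \<open>cnj z\<close> and under S differ by
  \<open>cnj z *\<^sub>C x\<close> alone. Pairing one with a vector orthogonal to the other leaves
  only this term, and \<open>norm x\<close> is controlled by the inverse of the closure.\<close>

lemma norm_diff_proj_le:
  assumes "Re z = 0"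
  shows "norm (orth_proj (def_space S z) x - orth_proj (op_ker (op_adj S)) x)
       \<le> (norm z * inv_norm) * norm x"
  \<comment> \<open>The kernel of the adjoint is the deficiency space at 0, so both projections are
    onto complements of ranges; \<open>op_minus S (cnj 0)\<close> is S itself.\<close>
  unfolding def_space_0[symmetric] def_space_eq
proof (rule norm_diff_orth_proj_le)
  have le: "norm z * norm x \<le> norm z * inv_norm * norm u" if "(x, u) \<in> S" for x u
    using mult_left_mono[OF norm_le_inv_norm[OF that], of "norm z"] by (simp add: mult_ac)
  show "0 \<le> norm z * inv_norm"
    using inv_norm_nonneg by simp
  fix h f
  {
    assume h: "h \<in> Range (op_minus S (cnj z))" and f: "f \<in> orth_compl (Range (op_minus S (cnj 0)))"
    obtain x u where xu: "(x, u) \<in> S" and h_eq: "h = u - cnj z *\<^sub>C x"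
      using h by (auto simp: op_minus_def)
    have "u \<in> Range (op_minus S (cnj 0))"
      using xu by (auto simp: Range_iff op_minus_iff)
    then have "cinner h f = - z * cinner x f"
      using f by (simp add: h_eq orth_compl_def cinner_diff_left cinner_scaleC_left)
    then have "norm (cinner h f) \<le> (norm z * norm x) * norm f"
      using mult_left_mono[OF Cauchy_Schwarz_cinner[of x f], of "norm z"]
      by (simp add: norm_mult mult_ac)
    also have "\<dots> \<le> (norm z * inv_norm * norm u) * norm f"
      using le[OF xu] by (intro mult_right_mono) auto
    \<comment> \<open>Since \<open>z\<close> is imaginary, the squared norm of \<open>h\<close>
      exceeds that of \<open>u\<close> by a nonnegative term, and \<open>u\<close> can be replaced
      by \<open>h\<close> at no cost.\<close>
    also have "\<dots> \<le> (norm z * inv_norm * norm h) * norm f"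
    proof -
      have "(norm u)\<^sup>2 \<le> (norm h)\<^sup>2"
        using norm_op_minus_sq[OF xu, of "cnj z"] assms by (simp add: h_eq)
      then have "norm u \<le> norm h"
        using power2_le_imp_le norm_ge_zero by blast
      then show ?thesis
        using inv_norm_nonneg by (intro mult_right_mono mult_left_mono) auto
    qed
    finally show "norm (cinner h f) \<le> norm z * inv_norm * norm h * norm f" .
  }
  {
    assume h: "h \<in> Range (op_minus S (cnj 0))" and f: "f \<in> orth_compl (Range (op_minus S (cnj z)))"
    obtain x where xh: "(x, h) \<in> S"
      using h by (auto simp: Range_iff op_minus_iff)
    have "h - cnj z *\<^sub>C x \<in> Range (op_minus S (cnj z))"
      using xh by (auto simp: Range_iff op_minus_iff intro!: exI[of _ x])
    then have "cinner (h - cnj z *\<^sub>C x) f = 0"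
      using f by (auto simp: orth_compl_def)
    then have "cinner h f = z * cinner x f"
      by (simp add: cinner_diff_left cinner_scaleC_left)
    then have "norm (cinner h f) \<le> (norm z * norm x) * norm f"
      using mult_left_mono[OF Cauchy_Schwarz_cinner[of x f], of "norm z"]
      by (simp add: norm_mult mult_ac)
    also have "\<dots> \<le> (norm z * inv_norm * norm h) * norm f"
      using le[OF xh] by (intro mult_right_mono) auto
    finally show "norm (cinner h f) \<le> norm z * inv_norm * norm h * norm f" .
  }
qed (intro csubspace_Range_op_minus csubspace_op)+

lemma onorm_diff_proj_le:
  assumes "Re z = 0"
  shows "onorm (\<lambda>x. orth_proj (def_space S z) x - orth_proj (op_ker (op_adj S)) x)
       \<le> norm z * inv_norm"
  using norm_diff_proj_le[OF assms] inv_norm_nonneg by (intro onorm_bound) auto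

text \<open>A squeeze between 0 and the linear bound. Keeping the imaginary direction
  \<open>z\<close> free makes both signs instances.\<close>

lemma tendsto_onorm_diff_proj:
  assumes "Re z = 0"
  shows "((\<lambda>\<epsilon>. onorm (\<lambda>x. orth_proj (def_space S (z * complex_of_real \<epsilon>)) x
           - orth_proj (op_ker (op_adj S)) x)) \<longlongrightarrow> 0) (at_right 0)"
proof (rule real_tendsto_sandwich[OF always_eventually always_eventually tendsto_const])
  have Re: "Re (z * complex_of_real \<epsilon>) = 0" for \<epsilon>
    using assms by simp
  show "\<forall>\<epsilon>. 0 \<le> onorm (\<lambda>x. orth_proj (def_space S (z * complex_of_real \<epsilon>)) x
           - orth_proj (op_ker (op_adj S)) x)"
    by (intro allI onorm_nonneg_if_bounded) (rule norm_diff_proj_le[OF Re])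
  show "\<forall>\<epsilon>. onorm (\<lambda>x. orth_proj (def_space S (z * complex_of_real \<epsilon>)) x
           - orth_proj (op_ker (op_adj S)) x) \<le> norm (z * complex_of_real \<epsilon>) * inv_norm"
    using onorm_diff_proj_le[OF Re] by blast
  show "((\<lambda>\<epsilon>. norm (z * complex_of_real \<epsilon>) * inv_norm) \<longlongrightarrow> 0) (at_right 0)"
    by (rule tendsto_eq_intros refl | simp)+
qed

text \<open>Additivity splits the projection of \<open>v + z *\<^sub>C g\<close>: the part from
  \<open>v\<close> is compared with the projection onto the kernel of the adjoint, and the part from
  \<open>g\<close> has norm at most \<open>norm z * norm g\<close>.\<close>

lemma norm_proj_op_minus_diff_le:
  assumes "Re z = 0" and g: "(g, v) \<in> op_adj S"
  shows "norm (orth_proj (def_space S z) (op_app (op_minus (op_adj S) (- z)) g) - Gamma1 S g)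
       \<le> norm z * (norm g + inv_norm * norm (op_app (op_adj S) g))"
proof -
  let ?P = "orth_proj (def_space S z)"
  note W = orth_compl_csubspace orth_compl_closed
  have v: "op_app (op_adj S) g = v"
    using op_app_eq[OF single_valued_op_adj[OF dense] g] .
  have "op_app (op_minus (op_adj S) (- z)) g = v + z *\<^sub>C g"
    using g by (intro op_app_eq single_valued_op_minus single_valued_op_adj dense)
      (simp add: op_minus_iff)
  then have "?P (op_app (op_minus (op_adj S) (- z)) g) - Gamma1 S g
      = (?P v - orth_proj (op_ker (op_adj S)) v) + ?P (z *\<^sub>C g)"
    by (simp add: Gamma1_def v def_space_eq orth_proj_add[OF W])
  also have "norm \<dots> \<le> (norm z * inv_norm) * norm v + norm (z *\<^sub>C g)"
    by (intro norm_triangle_le add_mono norm_diff_proj_le assms)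
      (simp add: def_space_eq norm_orth_proj_le[OF W])
  also have "\<dots> = norm z * (norm g + inv_norm * norm (op_app (op_adj S) g))"
    by (simp add: v norm_scaleC algebra_simps)
  finally show ?thesis .
qed

text \<open>For imaginary \<open>z\<close> the norm of \<open>u - z *\<^sub>C x\<close> controls
  that of \<open>u\<close>, and \<open>u\<close> controls \<open>x\<close>. Convergence in the range
  thus makes the underlying graph points Cauchy, and their limit lies in
  \<open>closure S\<close>.\<close>

lemma closure_Range_op_minus:
  assumes "Re z = 0" and h: "h \<in> closure (Range (op_minus S z))"
  obtains x u where "(x, u) \<in> closure S" "h = u - z *\<^sub>C x"
proof -
  obtain k where k: "\<And>n. k n \<in> Range (op_minus S z)" and lim: "k \<longlonglongrightarrow> h"
    using h unfolding closure_sequential by blast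
  have "\<exists>x u. (x, u) \<in> S \<and> k n = u - z *\<^sub>C x" for n
    using k[of n] by (auto simp: op_minus_def)
  then obtain x u where xu: "\<And>n. (x n, u n) \<in> S" and k_eq: "\<And>n. k n = u n - z *\<^sub>C x n"
    by metis
  have diff: "(x m - x n, u m - u n) \<in> S" for m n
    using op_graph_diff[OF csubspace_op xu xu] .
  have u_le: "norm (u m - u n) \<le> norm (k m - k n)" for m n
  proof (rule power2_le_imp_le)
    have "k m - k n = (u m - u n) - z *\<^sub>C (x m - x n)"
      by (simp add: k_eq complex_vector.scale_right_diff_distrib)
    then show "(norm (u m - u n))\<^sup>2 \<le> (norm (k m - k n))\<^sup>2"
      using norm_op_minus_sq[OF diff[of m n] assms(1)] by simp
  qed simp
  have "Cauchy k" using lim by (rule LIMSEQ_imp_Cauchy)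
  then have "Cauchy u"
    using u_le unfolding Cauchy_iff by (meson order_le_less_trans)
  have "Cauchy x"
  proof (rule CauchyI)
    fix e :: real assume "0 < e"
    \<comment> \<open>Adding 1 keeps the divisor positive even if \<open>inv_norm\<close> is
      0.\<close>
    with inv_norm_nonneg have "0 < e / (inv_norm + 1)" by simp
    then obtain M where M: "\<And>m n. m \<ge> M \<Longrightarrow> n \<ge> M \<Longrightarrow> norm (u m - u n) < e / (inv_norm + 1)"
      using \<open>Cauchy u\<close> unfolding Cauchy_iff by meson
    have "norm (x m - x n) < e" if mn: "m \<ge> M" "n \<ge> M" for m n
    proof -
      have "norm (x m - x n) \<le> inv_norm * norm (u m - u n)"
        by (rule norm_le_inv_norm[OF diff])
      also have "\<dots> \<le> (inv_norm + 1) * norm (u m - u n)"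
        by (simp add: mult_right_mono)
      also have "\<dots> < e"
        using M[OF mn] inv_norm_nonneg by (simp add: divide_simps mult_ac)
      finally show ?thesis .
    qed
    then show "\<exists>M. \<forall>m\<ge>M. \<forall>n\<ge>M. norm (x m - x n) < e" by blast
  qed
  then obtain x' u' where x': "x \<longlonglongrightarrow> x'" and u': "u \<longlonglongrightarrow> u'"
    using \<open>Cauchy u\<close> Cauchy_convergent convergent_def by blast
  have "(x', u') \<in> closure S"
    unfolding closure_sequential
    by (intro exI[of _ "\<lambda>n. (x n, u n)"]) (simp add: xu tendsto_Pair x' u')
  moreover have "k \<longlonglongrightarrow> u' - z *\<^sub>C x'"
    unfolding k_eq[abs_def] by (intro tendsto_intros x' u')
  then have "h = u' - z *\<^sub>C x'"
    using lim LIMSEQ_unique by blast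
  ultimately show thesis
    using that by blast
qed

text \<open>A vector \<open>y\<close> of the deficiency space satisfies the adjoint relation with
  value \<open>z *\<^sub>C y\<close>, and this relation extends from S to its closure.\<close>

lemma closure_op_orth_def_space:
  assumes "(f, v) \<in> closure S"
  shows "v - cnj z *\<^sub>C f \<in> orth_compl (def_space S z)"
proof -
  have "cinner y v = cinner (z *\<^sub>C y) f" if "y \<in> def_space S z" for y
    using that assms unfolding def_space_iff op_adj_closure[of S, symmetric] by (auto simp: op_adj_def)
  then show ?thesis
    by (simp add: orth_compl_def cinner_diff_right cinner_scaleC_left cinner_scaleC_right)
qed

text \<open>Von Neumann's decomposition is built here by projection as
  \<open>g = f + (1 / (2 * z)) *\<^sub>C p + d\<close>, with \<open>p\<close> and \<open>d\<close>
  in the deficiency spaces at \<open>z\<close> and \<open>- z\<close>. The maps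
  \<open>Gamma1_minus\<close> and \<open>Gamma1_plus\<close> recover \<open>2 * z\<close> and
  \<open>- (2 * z)\<close> times the respective components, so \<open>Upsilon\<close> returns their
  sum.\<close>

lemma Upsilon_eq:
  assumes "\<epsilon> > 0" and g: "(g, v) \<in> op_adj S"
  obtains f w where "(f, w) \<in> closure S" "Upsilon S \<epsilon> g = g - f"
proof -
  define z where "z = \<i> * complex_of_real \<epsilon>"
  have z: "Re z = 0" "cnj z = - z" "2 * z \<noteq> 0"
    using assms(1) by (auto simp: z_def)
  note sv = single_valued_op_adj[OF dense]
  define p where "p = orth_proj (def_space S z) (v + z *\<^sub>C g)"
  have p: "p \<in> def_space S z" "v + z *\<^sub>C g - p \<in> orth_compl (def_space S z)"
    unfolding p_def def_space_eq by (rule orth_proj_compl_in)+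
  \<comment> \<open>The deficiency space at \<open>z\<close> is the complement of the range of S +
    \<open>z\<close>, because \<open>cnj z = - z\<close>. The residual is therefore in the closure
    of that range, and so in the range of the closure of S shifted by \<open>z\<close>.\<close>
  have "v + z *\<^sub>C g - p \<in> closure (Range (op_minus S (- z)))"
    using p(2) z(2) orth_compl_orth_compl[OF csubspace_Range_op_minus[OF csubspace_op]]
    unfolding def_space_eq by simp
  then obtain f w where fw: "(f, w) \<in> closure S" and eq: "v + z *\<^sub>C g - p = w - (- z) *\<^sub>C f"
    using closure_Range_op_minus[of "- z"] z(1) by auto
  have eq': "w = v + z *\<^sub>C g - p - z *\<^sub>C f"
    using eq by (simp add: algebra_simps)
  \<comment> \<open>On the deficiency space at \<open>z\<close> the operator S* + \<open>z\<close>
    acts as multiplication by \<open>2 * z\<close>. The factor \<open>1 / (2 * z)\<close> makes it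
    send the removed terms to exactly \<open>v + z *\<^sub>C g\<close>, so it annihilates
    \<open>d\<close>.\<close>
  define d where "d = g - f - (1 / (2 * z)) *\<^sub>C p"
  have half: "z *\<^sub>C (1 / (2 * z)) *\<^sub>C p = (1/2) *\<^sub>C p" "(2 * z) *\<^sub>C (1 / (2 * z)) *\<^sub>C p = p"
    using z(3) by (simp_all add: scaleC_scaleC scaleC_one)
  have p2: "p = (1/2) *\<^sub>C p + (1/2::complex) *\<^sub>C p"
    by (simp add: scaleC_one flip: scaleC_add_left)
  have twice: "(2 * z) *\<^sub>C y = z *\<^sub>C y + z *\<^sub>C y" for y :: 'a
    by (simp flip: scaleC_add_left)
  have "(p, z *\<^sub>C p) \<in> op_adj S"
    using p(1) by (simp add: def_space_iff)
  from op_graph_scale[OF csubspace_op_adj this, of "1 / (2 * z)"]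
  have "((1 / (2 * z)) *\<^sub>C p, (1/2) *\<^sub>C p) \<in> op_adj S"
    using z(3) by (simp add: scaleC_scaleC)
  then have "(d, v - w - (1/2) *\<^sub>C p) \<in> op_adj S"
    using op_graph_diff[OF csubspace_op_adj] g fw closure_subset_adj unfolding d_def by blast
  moreover have "v - w - (1/2) *\<^sub>C p = (- z) *\<^sub>C d"
    unfolding d_def eq' complex_vector.scale_minus_left complex_vector.scale_right_diff_distrib half
    using p2 by (simp add: algebra_simps)
  ultimately have d: "d \<in> def_space S (- z)"
    by (simp add: def_space_iff)
  have minus: "Gamma1_minus S \<epsilon> g = p"
    using op_app_eq[OF single_valued_op_minus[OF sv], of g "v + z *\<^sub>C g" "- z"] g
    by (simp add: Gamma1_minus_def p_def op_minus_iff z_def)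
  have "Gamma1_plus S \<epsilon> g = orth_proj (def_space S (- z)) (v - z *\<^sub>C g)"
    using op_app_eq[OF single_valued_op_minus[OF sv], of g "v - z *\<^sub>C g" z] g
    by (simp add: Gamma1_plus_def op_minus_iff z_def)
  \<comment> \<open>S* - \<open>z\<close> kills the component in the deficiency space at
    \<open>z\<close>, multiplies \<open>d\<close> by \<open>- (2 * z)\<close>, and maps
    \<open>f\<close> to \<open>w - z *\<^sub>C f\<close>, which is orthogonal to the deficiency
    space at \<open>- z\<close>.\<close>
  also have "\<dots> = - (2 * z) *\<^sub>C d"
  proof (rule orth_proj_unique)
    show sub: "csubspace (def_space S (- z))"
      by (simp add: def_space_eq orth_compl_csubspace)
    show "- (2 * z) *\<^sub>C d \<in> def_space S (- z)"
      using complex_vector.subspace_scale[OF sub d] .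
    have "(2 * z) *\<^sub>C d = z *\<^sub>C g + z *\<^sub>C g - (z *\<^sub>C f + z *\<^sub>C f) - p"
      unfolding d_def complex_vector.scale_right_diff_distrib half twice
      using p2 by simp
    then have "v - z *\<^sub>C g - (- (2 * z) *\<^sub>C d) = w - cnj (- z) *\<^sub>C f"
      unfolding complex_vector.scale_minus_left eq' by (simp add: z(2))
    with closure_op_orth_def_space[OF fw, of "- z"]
    show "v - z *\<^sub>C g - (- (2 * z) *\<^sub>C d) \<in> orth_compl (def_space S (- z))"
      by simp
  qed
  finally have plus: "Gamma1_plus S \<epsilon> g = - (2 * z) *\<^sub>C d" .
  have "Upsilon S \<epsilon> g = (1 / (2 * z)) *\<^sub>C p + d"
    using z(3)
    by (simp add: Upsilon_def minus plus scaleC_add_right scaleC_scaleC scaleC_one mult.assoc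
        flip: z_def)
  then have "Upsilon S \<epsilon> g = g - f"
    by (simp add: d_def)
  with fw that show thesis
    by blast
qed

end

text \<open>Being equal to its adjoint, \<open>S\<^sub>D\<close> is closed and hence contains
  \<open>closure S\<close>. The vector \<open>f\<close> removed by \<open>Upsilon\<close> is then
  fixed when the adjoint is followed by the inverse of \<open>S\<^sub>D\<close>, so it contributes
  nothing to \<open>Gamma0\<close>.\<close>

lemma Gamma0_eps_eq:
  assumes "regular_symmetric_op S" and "\<epsilon> > 0" and g: "(g, v) \<in> op_adj S"
    and S\<^sub>D: "selfadjoint_op S\<^sub>D" "S \<subseteq> S\<^sub>D" "single_valued (S\<^sub>D\<inverse>)" "Domain (S\<^sub>D\<inverse>) = UNIV"
  shows "Gamma0_eps S S\<^sub>D \<epsilon> g = Gamma0 S S\<^sub>D g"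
proof -
  interpret regular_symmetric_op S by fact
  note sv = single_valued_op_adj[OF dense]
  obtain f w where fw: "(f, w) \<in> closure S" and U: "Upsilon S \<epsilon> g = g - f"
    using Upsilon_eq[OF assms(2) g] .
  have "closed S\<^sub>D" "csubspace S\<^sub>D"
    using S\<^sub>D closed_op_adj[of S\<^sub>D] by (auto simp: selfadjoint_op_def linear_op_def)
  then have fwD: "(f, w) \<in> S\<^sub>D"
    using S\<^sub>D(2) closure_minimal fw by blast
  \<comment> \<open>This \<open>k\<close> is the inverse of \<open>S\<^sub>D\<close> applied to
    \<open>v\<close>. Replacing \<open>g\<close> by \<open>g - f\<close> replaces it by
    \<open>k - f\<close>, and the two shifts cancel in \<open>Gamma0\<close>.\<close>
  obtain k where k: "(k, v) \<in> S\<^sub>D"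
    using S\<^sub>D(4) by (metis DomainE UNIV_I converse_iff)
  have "(g - f, v - w) \<in> op_adj S"
    using op_graph_diff[OF csubspace_op_adj g] fw closure_subset_adj by blast
  moreover have "(k - f, v - w) \<in> S\<^sub>D"
    using op_graph_diff[OF \<open>csubspace S\<^sub>D\<close> k fwD] .
  ultimately have "Gamma0 S S\<^sub>D (g - f) = (g - f) - (k - f)" "Gamma0 S S\<^sub>D g = g - k"
    using op_app_eq[OF sv] op_app_eq[OF S\<^sub>D(3)] g k unfolding Gamma0_def by (metis converse_iff)+
  then show ?thesis
    by (simp add: Gamma0_eps_def U)
qed

section \<open>Convergence from linear bounds, and the final assembly\<close>

lemma tendsto_at_right_0_if_linear_bound:
  fixes f :: "real \<Rightarrow> 'a::real_normed_vector"
  assumes "\<And>\<epsilon>. \<epsilon> > 0 \<Longrightarrow> norm (f \<epsilon> - l) \<le> \<epsilon> * B"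
  shows "(f \<longlongrightarrow> l) (at_right 0)"
proof -
  have "((\<lambda>\<epsilon>. f \<epsilon> - l) \<longlongrightarrow> 0) (at_right 0)"
  proof (rule Lim_null_comparison)
    show "\<forall>\<^sub>F \<epsilon> in at_right 0. norm (f \<epsilon> - l) \<le> \<epsilon> * B"
      using assms by (auto simp: eventually_at_right_field intro: exI[of _ 1])
    show "((\<lambda>\<epsilon>. \<epsilon> * B) \<longlongrightarrow> 0) (at_right 0)"
      by (rule tendsto_eq_intros refl | simp)+
  qed
  then show ?thesis
    by (simp add: Lim_null[symmetric])
qed

theorem theorem2p1:
  fixes S S\<^sub>D :: "('a::complex_hilbert \<times> 'a) set" and z\<^sub>0 :: complex
  assumes "densely_defined S" and "symmetric_op S"
    and "zero_regular (closure S)"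
    and "z\<^sub>0 = 0 \<or> Im z\<^sub>0 \<noteq> 0" and "(BNF_Cardinal_Arithmetic.cone, deficiency_index S z\<^sub>0) \<in> ordLeq"
    and "selfadjoint_op S\<^sub>D" and "S \<subseteq> S\<^sub>D"
    and "single_valued (S\<^sub>D\<inverse>)" and "Domain (S\<^sub>D\<inverse>) = UNIV" and "bounded_op (S\<^sub>D\<inverse>)"
  shows
    "(\<forall>\<epsilon>>0.
        onorm (\<lambda>x. orth_proj (def_space S (- (\<i> * complex_of_real \<epsilon>))) x
                 - orth_proj (op_ker (op_adj S)) x) \<le> \<epsilon> * op_norm ((closure S)\<inverse>) \<and>
        onorm (\<lambda>x. orth_proj (def_space S (\<i> * complex_of_real \<epsilon>)) x
                 - orth_proj (op_ker (op_adj S)) x) \<le> \<epsilon> * op_norm ((closure S)\<inverse>)) \<and>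
     ((\<lambda>\<epsilon>. onorm (\<lambda>x. orth_proj (def_space S (- (\<i> * complex_of_real \<epsilon>))) x
                 - orth_proj (op_ker (op_adj S)) x)) \<longlongrightarrow> 0) (at_right 0) \<and>
     ((\<lambda>\<epsilon>. onorm (\<lambda>x. orth_proj (def_space S (\<i> * complex_of_real \<epsilon>)) x
                 - orth_proj (op_ker (op_adj S)) x)) \<longlongrightarrow> 0) (at_right 0) \<and>
     (\<forall>g\<in>Domain (op_adj S).
       (\<forall>\<epsilon>>0.
          norm (Gamma1_plus S \<epsilon> g - Gamma1 S g)
            \<le> \<epsilon> * (norm g + op_norm ((closure S)\<inverse>) * norm (op_app (op_adj S) g)) \<and>
          norm (Gamma1_minus S \<epsilon> g - Gamma1 S g)
            \<le> \<epsilon> * (norm g + op_norm ((closure S)\<inverse>) * norm (op_app (op_adj S) g))) \<and>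
       ((\<lambda>\<epsilon>. Gamma1_plus S \<epsilon> g) \<longlongrightarrow> Gamma1 S g) (at_right 0) \<and>
       ((\<lambda>\<epsilon>. Gamma1_minus S \<epsilon> g) \<longlongrightarrow> Gamma1 S g) (at_right 0)) \<and>
     (\<forall>g\<in>Domain (op_adj S).
       (\<forall>\<epsilon>>0.
          norm (Gamma0_eps S S\<^sub>D \<epsilon> g - Gamma0 S S\<^sub>D g)
            \<le> \<epsilon> * (op_norm ((closure S)\<inverse>) + op_norm (S\<^sub>D\<inverse>))
                * (norm g + op_norm ((closure S)\<inverse>) * norm (op_app (op_adj S) g))) \<and>
       ((\<lambda>\<epsilon>. Gamma0_eps S S\<^sub>D \<epsilon> g) \<longlongrightarrow> Gamma0 S S\<^sub>D g) (at_right 0))"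
proof -
  have "regular_symmetric_op S"
    using assms(1-3) by (simp add: regular_symmetric_op_def)
  then interpret regular_symmetric_op S .
  have i: "onorm (\<lambda>x. orth_proj (def_space S (- (\<i> * complex_of_real \<epsilon>))) x
             - orth_proj (op_ker (op_adj S)) x) \<le> \<epsilon> * inv_norm"
          "onorm (\<lambda>x. orth_proj (def_space S (\<i> * complex_of_real \<epsilon>)) x
             - orth_proj (op_ker (op_adj S)) x) \<le> \<epsilon> * inv_norm" if "\<epsilon> > 0" for \<epsilon>
    using onorm_diff_proj_le[of "- (\<i> * complex_of_real \<epsilon>)"]
      onorm_diff_proj_le[of "\<i> * complex_of_real \<epsilon>"] that
    by (simp_all add: norm_mult)
  have ii: "norm (Gamma1_plus S \<epsilon> g - Gamma1 S g)
              \<le> \<epsilon> * (norm g + inv_norm * norm (op_app (op_adj S) g))"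
           "norm (Gamma1_minus S \<epsilon> g - Gamma1 S g)
              \<le> \<epsilon> * (norm g + inv_norm * norm (op_app (op_adj S) g))"
    if "g \<in> Domain (op_adj S)" "\<epsilon> > 0" for g \<epsilon>
  proof -
    obtain v where "(g, v) \<in> op_adj S"
      using \<open>g \<in> Domain (op_adj S)\<close> by blast
    \<comment> \<open>The signs cross over: the plus map projects onto the deficiency space at minus
      i times \<epsilon>, so it is the instance with negative imaginary \<open>z\<close>.\<close>
    then show "norm (Gamma1_plus S \<epsilon> g - Gamma1 S g)
              \<le> \<epsilon> * (norm g + inv_norm * norm (op_app (op_adj S) g))"
           "norm (Gamma1_minus S \<epsilon> g - Gamma1 S g)
              \<le> \<epsilon> * (norm g + inv_norm * norm (op_app (op_adj S) g))"
      using norm_proj_op_minus_diff_le[of "- (\<i> * complex_of_real \<epsilon>)" g v]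
        norm_proj_op_minus_diff_le[of "\<i> * complex_of_real \<epsilon>" g v] \<open>\<epsilon> > 0\<close>
      by (simp_all add: norm_mult Gamma1_plus_def Gamma1_minus_def)
  qed
  have "(0, 0) \<in> S\<^sub>D\<inverse>"
    using complex_vector.subspace_0[OF csubspace_op] assms(7) by (auto simp: zero_prod_def)
  then have D: "0 \<le> op_norm (S\<^sub>D\<inverse>)"
    using assms(8,10) by (rule op_norm_bounded)
  \<comment> \<open>The left side is 0 because the two maps coincide, so only nonnegativity of the
    right side is at stake. The factors are grouped to fit the lemma on linear bounds.\<close>
  have iii: "norm (Gamma0_eps S S\<^sub>D \<epsilon> g - Gamma0 S S\<^sub>D g)
            \<le> \<epsilon> * ((inv_norm + op_norm (S\<^sub>D\<inverse>)) * (norm g + inv_norm * norm (op_app (op_adj S) g)))"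
    if "g \<in> Domain (op_adj S)" "\<epsilon> > 0" for g \<epsilon>
    using Gamma0_eps_eq[OF \<open>regular_symmetric_op S\<close> that(2) _ assms(6-9)] that inv_norm_nonneg D
    by auto
  show ?thesis
  proof (intro conjI ballI)
    show "((\<lambda>\<epsilon>. onorm (\<lambda>x. orth_proj (def_space S (- (\<i> * complex_of_real \<epsilon>))) x
        - orth_proj (op_ker (op_adj S)) x)) \<longlongrightarrow> 0) (at_right 0)"
      using tendsto_onorm_diff_proj[of "- \<i>"] by simp
    show "((\<lambda>\<epsilon>. onorm (\<lambda>x. orth_proj (def_space S (\<i> * complex_of_real \<epsilon>)) x
        - orth_proj (op_ker (op_adj S)) x)) \<longlongrightarrow> 0) (at_right 0)"
      using tendsto_onorm_diff_proj[of \<i>] by simp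
  next
    fix g assume g: "g \<in> Domain (op_adj S)"
    show "((\<lambda>\<epsilon>. Gamma1_plus S \<epsilon> g) \<longlongrightarrow> Gamma1 S g) (at_right 0)"
      using ii(1)[OF g] by (rule tendsto_at_right_0_if_linear_bound)
    show "((\<lambda>\<epsilon>. Gamma1_minus S \<epsilon> g) \<longlongrightarrow> Gamma1 S g) (at_right 0)"
      using ii(2)[OF g] by (rule tendsto_at_right_0_if_linear_bound)
    show "((\<lambda>\<epsilon>. Gamma0_eps S S\<^sub>D \<epsilon> g) \<longlongrightarrow> Gamma0 S S\<^sub>D g) (at_right 0)"
      using iii[OF g] by (rule tendsto_at_right_0_if_linear_bound)
  qed (use i ii iii in \<open>auto simp: mult.assoc\<close>)
qed

end
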